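(* Let $n\geqslant 1$, and for $1\leqslant i\leqslant n$ let $K_i=\mathbf{B}(w_i,r_i)$ with $w_i\in\mathbb{R}^d$ and $r_i>0$. Let $\Lambda\subseteq\mathbb{R}^d$ be a lattice such that $(K_i-K_j)\cap\Lambda=\varnothing$ for all $1\leqslant i<j\leqslant n$. Then there exist $u_i\in w_i+\Lambda$ ($1\leqslant i\leqslant n$) such that, writing $K_i'=\mathbf{B}(u_i,r_i)$, we have $(K_i'-K_j')\cap t\Lambda=\varnothing$ for all real $t\geqslant1$ and all $1\leqslant i<j\leqslant n$.
   Context: $\mathbf{B}(w,r)$ denotes the closed Euclidean ball of radius $r$ centered at $w$. A lattice is the $\mathbb{Z}$-span of a basis of $\mathbb{R}^d$. For sets $A,B$, $A-B=\{a-b: a\in A, b\in B\}$, and $t\Lambda=\{t\lambda:\lambda\in\Lambda\}$. *)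

theory Defs
  imports "HOL-Analysis.Analysis"
begin

definition int_span :: "'a::real_vector set \<Rightarrow> 'a set" where
  "int_span B = {\<Sum>b\<in>F. of_int (c b) *\<^sub>R b | F c. finite F \<and> F \<subseteq> B}"

definition is_lattice :: "(real ^ 'd) set \<Rightarrow> bool" where
  "is_lattice L \<longleftrightarrow> (\<exists>B. independent B \<and> span B = UNIV \<and> L = int_span B)"

text \<open>The infix minus on sets is set-theoretic difference, so the set of pairwise
  differences needs its own name.\<close>

definition diff_set :: "'a::minus set \<Rightarrow> 'a set \<Rightarrow> 'a set" where
  "diff_set A B = {a - b | a b. a \<in> A \<and> b \<in> B}"

end

theory Submission
  imports Defs
begin

text \<open>Choose \<open>u i\<close> to be a shortest vector of \<open>w i + \<Lambda>\<close>, so that it lies in the Voronoi cell of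
  \<open>\<Lambda>\<close> at the origin: \<open>2 (u i \<bullet> \<lambda>) \<le> \<lambda> \<bullet> \<lambda>\<close> for all \<open>\<lambda> \<in> \<Lambda>\<close>.  Then \<open>v = u i - u j\<close> satisfies
  \<open>v \<bullet> \<lambda> \<le> \<lambda> \<bullet> \<lambda>\<close>, so the squared distance from \<open>v\<close> to \<open>t \<lambda>\<close> is a nondecreasing function of
  \<open>t \<ge> 1\<close>, and disjointness at \<open>t = 1\<close> is the hypothesis translated by a vector of \<open>\<Lambda>\<close>.\<close>

text \<open>Padding with zero coefficients turns a sum over part of \<open>B\<close> into one over
  all of \<open>B\<close>, so lattice points share one index set and can be handled
  coefficientwise.\<close>

lemma int_span_finite:
  assumes "finite B"
  shows "int_span B = range (\<lambda>c. \<Sum>b\<in>B. of_int (c b) *\<^sub>R b)"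
proof (intro equalityI subsetI)
  fix x assume "x \<in> int_span B"
  then obtain F c where F: "finite F" "F \<subseteq> B" and x: "x = (\<Sum>b\<in>F. of_int (c b) *\<^sub>R b)"
    unfolding int_span_def by blast
  define d where "d b = (if b \<in> F then c b else 0)" for b
  have "x = (\<Sum>b\<in>B. of_int (d b) *\<^sub>R b)"
    unfolding x d_def by (rule sum.mono_neutral_cong_left) (use F assms in auto)
  then show "x \<in> range (\<lambda>c. \<Sum>b\<in>B. of_int (c b) *\<^sub>R b)"
    by blast
next
  fix x assume "x \<in> range (\<lambda>c. \<Sum>b\<in>B. of_int (c b) *\<^sub>R b)"
  then show "x \<in> int_span B"
    using assms unfolding int_span_def by blast
qed

lemma lattice_basis:
  fixes L :: "(real ^ 'd) set"
  assumes "is_lattice L"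
  obtains B where "finite B" "independent B" "span B = UNIV"
    "L = range (\<lambda>c. \<Sum>b\<in>B. of_int (c b) *\<^sub>R b)"
proof -
  obtain B where B: "independent B" "span B = UNIV" "L = int_span B"
    using assms unfolding is_lattice_def by blast
  then have "finite B"
    by (simp add: independent_imp_finite)
  with B that show thesis
    by (simp add: int_span_finite)
qed

lemma lattice_diff:
  assumes "is_lattice L" "x \<in> L" "y \<in> L"
  shows "x - y \<in> L"
proof -
  obtain B where L: "L = range (\<lambda>c. \<Sum>b\<in>B. of_int (c b) *\<^sub>R b)"
    using assms(1) by (rule lattice_basis)
  obtain c d where "x = (\<Sum>b\<in>B. of_int (c b) *\<^sub>R b)" "y = (\<Sum>b\<in>B. of_int (d b) *\<^sub>R b)"
    using assms(2,3) unfolding L by blast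
  then have "x - y = (\<Sum>b\<in>B. of_int (c b - d b) *\<^sub>R b)"
    by (simp add: sum_subtractf scaleR_diff_left)
  then show ?thesis
    unfolding L by (intro range_eqI[of _ _ "\<lambda>b. c b - d b"])
qed

lemma lattice_zero:
  assumes "is_lattice L"
  shows "0 \<in> L"
proof -
  obtain B where L: "L = range (\<lambda>c. \<Sum>b\<in>B. of_int (c b) *\<^sub>R b)"
    using assms by (rule lattice_basis)
  show ?thesis
    unfolding L by (rule range_eqI[of _ _ "\<lambda>_. 0"]) simp
qed

lemma lattice_uminus:
  assumes "is_lattice L" "x \<in> L"
  shows "- x \<in> L"
  using lattice_diff[OF assms(1) lattice_zero[OF assms(1)] assms(2)] by simp

text \<open>Each coordinate with respect to the basis is a linear functional, hence bounded in
  finite dimension. Lattice points in the ball therefore have integer coordinates in a fixed finite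
  box.\<close>

lemma finite_lattice_Int_cball:
  fixes L :: "(real ^ 'd) set"
  assumes "is_lattice L"
  shows "finite (L \<inter> cball 0 R)"
proof -
  obtain B where B: "finite B" "independent B" "span B = UNIV"
    and L: "L = range (\<lambda>c. \<Sum>b\<in>B. of_int (c b) *\<^sub>R b)"
    using assms by (rule lattice_basis)
  have "bounded_linear (\<lambda>x. representation B x b)" for b
    by (intro linear_conv_bounded_linear[THEN iffD1] linearI)
      (use B in \<open>simp_all add: representation_add representation_scale\<close>)
  then have "\<forall>b. \<exists>K. \<forall>x. norm (representation B x b) \<le> norm x * K"
    using bounded_linear.bounded by blast
  then obtain K where K: "\<bar>representation B x b\<bar> \<le> norm x * K b" for x b
    by (metis real_norm_def)
  define S where "S = Pi\<^sub>E B (\<lambda>b. {- \<lceil>R * K b\<rceil>..\<lceil>R * K b\<rceil>})"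
  have "L \<inter> cball 0 R \<subseteq> (\<lambda>c. \<Sum>b\<in>B. of_int (c b) *\<^sub>R b) ` S"
  proof
    fix x assume "x \<in> L \<inter> cball 0 R"
    then obtain c where x: "x = (\<Sum>b\<in>B. of_int (c b) *\<^sub>R b)" and R: "norm x \<le> R"
      unfolding L by auto
    have "\<bar>c b\<bar> \<le> \<lceil>R * K b\<rceil>" if "b \<in> B" for b
    proof -
      have "representation B x b = (\<Sum>a\<in>B. of_int (c a) * representation B a b)"
        unfolding x using B by (simp add: representation_sum representation_scale)
      also have "\<dots> = (\<Sum>a\<in>B. if a = b then of_int (c a) else 0)"
        using B by (intro sum.cong) (auto simp: representation_basis)
      also have "\<dots> = of_int (c b)"
        using B that by simp
      finally have *: "\<bar>real_of_int (c b)\<bar> \<le> norm x * K b"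
        using K[of x b] by simp
      \<comment> \<open>The bound came without a sign for \<open>K b\<close>, which is needed to
        replace \<open>norm x\<close> by \<open>R\<close>. The vector \<open>b\<close> itself, whose
        coordinate at \<open>b\<close> is 1, settles it.\<close>
      have "0 \<le> K b"
      proof (rule ccontr)
        assume "\<not> 0 \<le> K b"
        then have "norm b * K b \<le> 0"
          by (simp add: mult_nonneg_nonpos)
        moreover have "1 \<le> norm b * K b"
          using K[of b b] B that by (simp add: representation_basis)
        ultimately show False
          by simp
      qed
      then have "norm x * K b \<le> R * K b"
        using R by (rule mult_right_mono[rotated])
      with * show ?thesis
        by linarith
    qed
    \<comment> \<open>\<open>S\<close> contains only extensional functions, which keeps it finite;
      the sum sees only the values of \<open>c\<close> on \<open>B\<close>.\<close>
    then have "restrict c B \<in> S"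
      unfolding S_def by (force simp: abs_le_iff)
    moreover have "x = (\<Sum>b\<in>B. of_int (restrict c B b) *\<^sub>R b)"
      unfolding x by (intro sum.cong) auto
    ultimately show "x \<in> (\<lambda>c. \<Sum>b\<in>B. of_int (c b) *\<^sub>R b) ` S"
      by blast
  qed
  moreover have "finite S"
    unfolding S_def using B by (intro finite_PiE) auto
  ultimately show ?thesis
    by (meson finite_imageI finite_subset)
qed

text \<open>Only finitely many points of the coset are no longer than \<open>w\<close>, and
  \<open>w\<close> is one of them, so a shortest one exists among these.\<close>

lemma lattice_coset_shortest:
  fixes L :: "(real ^ 'd) set"
  assumes "is_lattice L"
  obtains u where "u \<in> (+) w ` L" "\<And>y. y \<in> L \<Longrightarrow> norm u \<le> norm (u - y)"
proof -
  define S where "S = {x \<in> (+) w ` L. norm x \<le> norm w}"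
  have "S \<subseteq> (+) w ` (L \<inter> cball 0 (2 * norm w))"
  proof
    fix x assume "x \<in> S"
    then obtain y where y: "y \<in> L" "x = w + y" "norm (w + y) \<le> norm w"
      unfolding S_def by auto
    have "norm y \<le> norm (w + y) + norm w"
      using norm_triangle_ineq4[of "w + y" w] by simp
    with y show "x \<in> (+) w ` (L \<inter> cball 0 (2 * norm w))"
      by auto
  qed
  then have "finite S"
    using finite_lattice_Int_cball[OF assms] by (meson finite_imageI finite_subset)
  moreover have "w \<in> S"
    using lattice_zero[OF assms] unfolding S_def by force
  ultimately obtain u where u: "u \<in> S" "\<And>x. x \<in> S \<Longrightarrow> norm u \<le> norm x"
    using arg_min_if_finite(1)[of S norm] arg_min_least[of S _ norm] by (metis empty_iff)
  show ?thesis
  proof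
    show "u \<in> (+) w ` L"
      using u unfolding S_def by simp
    fix y assume "y \<in> L"
    then have "u - y \<in> (+) w ` L"
      using u(1) lattice_diff[OF assms] unfolding S_def by (auto simp flip: add_diff_eq)
    \<comment> \<open>A coset point outside \<open>S\<close> is longer than \<open>w\<close>, hence
      longer than \<open>u\<close>.\<close>
    then show "norm u \<le> norm (u - y)"
      using u unfolding S_def by fastforce
  qed
qed

lemma inner_le_half_if_norm_le:
  fixes u y :: "'a::real_inner"
  assumes "norm u \<le> norm (u - y)"
  shows "2 * (u \<bullet> y) \<le> y \<bullet> y"
  using assms unfolding norm_le by (simp add: algebra_simps inner_commute)

lemma norm_diff_le_norm_diff_scaleR:
  fixes v y :: "'a::real_inner"
  assumes "v \<bullet> y \<le> y \<bullet> y" "t \<ge> 1"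
  shows "norm (v - y) \<le> norm (v - t *\<^sub>R y)"
proof -
  have "2 * (y \<bullet> y) \<le> (t + 1) * (y \<bullet> y)"
    using assms by (intro mult_right_mono) auto
  \<comment> \<open>This product is exactly the squared norm of \<open>v - t *\<^sub>R y\<close>
    minus that of \<open>v - y\<close>.\<close>
  then have "0 \<le> (t - 1) * ((t + 1) * (y \<bullet> y) - 2 * (v \<bullet> y))"
    using assms by (intro mult_nonneg_nonneg) linarith+
  then show ?thesis
    unfolding norm_le by (simp add: algebra_simps inner_commute)
qed

text \<open>This turns disjointness from a lattice into a lower bound on distances from the
  difference of the centers.\<close>

lemma diff_set_cball:
  fixes a b :: "'a::real_normed_vector"
  assumes "r > 0" "s > 0"
  shows "diff_set (cball a r) (cball b s) = cball (a - b) (r + s)"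
proof (intro equalityI subsetI)
  fix x assume "x \<in> diff_set (cball a r) (cball b s)"
  then obtain p q where "x = p - q" "dist a p \<le> r" "dist b q \<le> s"
    unfolding diff_set_def by auto
  moreover have "norm ((a - p) - (b - q)) \<le> norm (a - p) + norm (b - q)"
    by (rule norm_triangle_ineq4)
  moreover have "(a - p) - (b - q) = a - b - (p - q)"
    by simp
  ultimately show "x \<in> cball (a - b) (r + s)"
    by (simp add: dist_norm)
next
  fix x assume "x \<in> cball (a - b) (r + s)"
  \<comment> \<open>The displacement of \<open>x\<close> from \<open>a - b\<close>, scaled into the
    unit ball, is shared between the two balls in the ratio \<open>r : s\<close>, with opposite
    signs.\<close>
  define z where "z = (x - (a - b)) /\<^sub>R (r + s)"
  have "norm (x - (a - b)) \<le> r + s"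
    using \<open>x \<in> cball (a - b) (r + s)\<close> by (simp add: dist_norm norm_minus_commute)
  then have z: "norm z \<le> 1"
    using assms unfolding z_def by (simp add: divide_simps)
  have "x - (a - b) = (r + s) *\<^sub>R z"
    using assms unfolding z_def by simp
  then have "x = (a + r *\<^sub>R z) - (b - s *\<^sub>R z)"
    by (simp add: algebra_simps)
  moreover have "a + r *\<^sub>R z \<in> cball a r" "b - s *\<^sub>R z \<in> cball b s"
    using assms z by (simp_all add: dist_norm mult_left_le)
  ultimately show "x \<in> diff_set (cball a r) (cball b s)"
    unfolding diff_set_def by blast
qed

theorem theorem2:
  fixes n :: nat and w :: "nat \<Rightarrow> real ^ 'd" and r :: "nat \<Rightarrow> real"
    and \<Lambda> :: "(real ^ 'd) set"
  assumes "n \<ge> 1"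
    and "\<And>i. i \<in> {1..n} \<Longrightarrow> r i > 0"
    and "is_lattice \<Lambda>"
    and "\<And>i j. 1 \<le> i \<Longrightarrow> i < j \<Longrightarrow> j \<le> n \<Longrightarrow>
           diff_set (cball (w i) (r i)) (cball (w j) (r j)) \<inter> \<Lambda> = {}"
  shows "\<exists>u :: nat \<Rightarrow> real ^ 'd.
           (\<forall>i\<in>{1..n}. u i \<in> (+) (w i) ` \<Lambda>) \<and>
           (\<forall>t::real. t \<ge> 1 \<longrightarrow> (\<forall>i j. 1 \<le> i \<and> i < j \<and> j \<le> n \<longrightarrow>
              diff_set (cball (u i) (r i)) (cball (u j) (r j)) \<inter> (\<lambda>x. t *\<^sub>R x) ` \<Lambda> = {}))"
proof -
  have "\<forall>i. \<exists>u. u \<in> (+) (w i) ` \<Lambda> \<and> (\<forall>y\<in>\<Lambda>. norm u \<le> norm (u - y))"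
    using lattice_coset_shortest[OF assms(3)] by metis
  then obtain u where u: "\<And>i. u i \<in> (+) (w i) ` \<Lambda>"
    and short: "\<And>i y. y \<in> \<Lambda> \<Longrightarrow> norm (u i) \<le> norm (u i - y)"
    by metis
  have "diff_set (cball (u i) (r i)) (cball (u j) (r j)) \<inter> (\<lambda>x. t *\<^sub>R x) ` \<Lambda> = {}"
    if "t \<ge> 1" "1 \<le> i" "i < j" "j \<le> n" for t :: real and i j
  proof -
    have pos: "r i > 0" "r j > 0"
      using assms(2) that by auto
    obtain a b where ab: "a \<in> \<Lambda>" "b \<in> \<Lambda>" "u i = w i + a" "u j = w j + b"
      using u[of i] u[of j] by blast
    have "t *\<^sub>R y \<notin> cball (u i - u j) (r i + r j)" if y: "y \<in> \<Lambda>" for y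
    proof -
      \<comment> \<open>Passing from the \<open>w\<close> to the \<open>u\<close> shifts the
        difference of centers by \<open>a - b\<close>, so the hypothesis is applied to the lattice
        point shifted back.\<close>
      have "y - (a - b) \<in> \<Lambda>"
        using assms(3) ab y by (intro lattice_diff)
      then have "y - (a - b) \<notin> cball (w i - w j) (r i + r j)"
        using assms(4)[of i j] \<open>1 \<le> i\<close> \<open>i < j\<close> \<open>j \<le> n\<close> pos by (auto simp: diff_set_cball)
      moreover have "w i - w j - (y - (a - b)) = u i - u j - y"
        unfolding ab by simp
      ultimately have far: "r i + r j < norm (u i - u j - y)"
        by (simp add: dist_norm)
      have "2 * (u i \<bullet> y) \<le> y \<bullet> y"
        using short[OF y] by (rule inner_le_half_if_norm_le)
      \<comment> \<open>Since \<open>u j\<close> enters with a minus sign, its inequality is taken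
        at \<open>- y\<close>; adding the two and halving bounds the inner product of
        \<open>u i - u j\<close> with \<open>y\<close>.\<close>
      moreover have "2 * (u j \<bullet> - y) \<le> - y \<bullet> - y"
        using short[OF lattice_uminus[OF assms(3) y]] by (rule inner_le_half_if_norm_le)
      ultimately have "(u i - u j) \<bullet> y \<le> y \<bullet> y"
        by (simp add: inner_diff_left)
      then have "norm (u i - u j - y) \<le> norm (u i - u j - t *\<^sub>R y)"
        using \<open>t \<ge> 1\<close> by (rule norm_diff_le_norm_diff_scaleR)
      with far show ?thesis
        by (simp add: dist_norm)
    qed
    then show ?thesis
      using pos by (auto simp: diff_set_cball)
  qed
  with u show ?thesis
    by blast
qed

end
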